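(* There exists an instance of $P||C_{\min}$ for which no convex set (in particular no polyhedron) is an $\alpha$-approximate supply polyhedron for any $\alpha<1.001$. In particular, there cannot exist $\alpha$-approximate supply polyhedra (or convex sets) with $\alpha<1.001$ for all instances of $P||C_{\min}$.
   Context: $Q||C_{\min}$: given $m$ machines with demands $D_1,\dots,D_m>0$ and $n$ job types with capacities $c_1,\dots,c_n>0$. A supply vector $s=(s_1,\dots,s_n)\in\mathbb{Z}_{\ge0}^n$ is feasible if the multiset consisting of $s_j$ jobs of capacity $c_j$ for each $j$ can be assigned (each job to at most one machine) so that every machine $i$ receives total capacity at least $D_i$. $P||C_{\min}$ is the special case in which all demands $D_i$ are equal. A set $\mathcal{P}\subseteq\mathbb{R}^n$ (polyhedron or convex set) is an $\alpha$-approximate supply polyhedron for the instance if (a) every feasible supply vector lies in $\mathcal{P}$, and (b) for every non-negative integer vector $s\in\mathcal{P}$, the $s_j$ jobs of capacity $c_j$ can be assigned to machines so that every machine $i$ receives total capacity at least $D_i/\alpha$. *)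

theory Defs
  imports Complex_Main "Jordan_Normal_Form.Matrix"
begin

text \<open>
  The number of job types is part of an instance and hence bound inside the formulas, so the
  space of real n-vectors is rendered as \<open>carrier_vec n\<close> rather than by a finite index type.
\<close>

record sched_instance =
  demand :: "real vec"
  capacity :: "real vec"

abbreviation num_machines :: "sched_instance \<Rightarrow> nat" where
  "num_machines I \<equiv> dim_vec (demand I)"

abbreviation num_types :: "sched_instance \<Rightarrow> nat" where
  "num_types I \<equiv> dim_vec (capacity I)"

definition Q_Cmin_instance :: "sched_instance \<Rightarrow> bool" where
  "Q_Cmin_instance I \<longleftrightarrow>
     num_machines I \<ge> 1 \<and> num_types I \<ge> 1 \<and>
     (\<forall>i < num_machines I. demand I $ i > 0) \<and>
     (\<forall>j < num_types I. capacity I $ j > 0)"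

definition P_Cmin_instance :: "sched_instance \<Rightarrow> bool" where
  "P_Cmin_instance I \<longleftrightarrow> Q_Cmin_instance I \<and>
     (\<forall>i < num_machines I. \<forall>i' < num_machines I. demand I $ i = demand I $ i')"

text \<open>The pair \<open>(j, k)\<close> is the \<open>k\<close>-th of the \<open>s $ j\<close> jobs of type \<open>j\<close>.\<close>

definition jobs :: "nat vec \<Rightarrow> (nat \<times> nat) set" where
  "jobs s = (SIGMA j:{..<dim_vec s}. {..<s $ j})"

text \<open>
  An assignment is a partial map from jobs to machines; jobs outside its domain stay unassigned.
  The target \<open>T i\<close> is the total capacity that machine \<open>i\<close> has to receive.
\<close>

definition assignable :: "sched_instance \<Rightarrow> (nat \<Rightarrow> real) \<Rightarrow> nat vec \<Rightarrow> bool" where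
  "assignable I T s \<longleftrightarrow>
     (\<exists>\<sigma> :: nat \<times> nat \<rightharpoonup> nat.
        dom \<sigma> \<subseteq> jobs s \<and> ran \<sigma> \<subseteq> {..<num_machines I} \<and>
        (\<forall>i < num_machines I.
           (\<Sum>p \<in> {p \<in> jobs s. \<sigma> p = Some i}. capacity I $ fst p) \<ge> T i))"

definition feasible_supply :: "sched_instance \<Rightarrow> nat vec \<Rightarrow> bool" where
  "feasible_supply I s \<longleftrightarrow>
     s \<in> carrier_vec (num_types I) \<and> assignable I (\<lambda>i. demand I $ i) s"

definition approx_supply_set :: "real \<Rightarrow> sched_instance \<Rightarrow> real vec set \<Rightarrow> bool" where
  "approx_supply_set \<alpha> I P \<longleftrightarrow>
     P \<subseteq> carrier_vec (num_types I) \<and>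
     (\<forall>s. feasible_supply I s \<longrightarrow> map_vec real s \<in> P) \<and>
     (\<forall>s \<in> carrier_vec (num_types I).
        map_vec real s \<in> P \<longrightarrow> assignable I (\<lambda>i. demand I $ i / \<alpha>) s)"

text \<open>
  The type \<open>real vec\<close> contains vectors of all dimensions and is not a \<open>real_vector\<close>, so the
  usual definition of convexity is repeated here relative to the carrier.
\<close>

definition convex_vec_set :: "nat \<Rightarrow> real vec set \<Rightarrow> bool" where
  "convex_vec_set n P \<longleftrightarrow> P \<subseteq> carrier_vec n \<and>
     (\<forall>x \<in> P. \<forall>y \<in> P. \<forall>u \<ge> 0. \<forall>v \<ge> 0. u + v = 1 \<longrightarrow> u \<cdot>\<^sub>v x + v \<cdot>\<^sub>v y \<in> P)"

definition polyhedron_vec_set :: "nat \<Rightarrow> real vec set \<Rightarrow> bool" where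
  "polyhedron_vec_set n P \<longleftrightarrow>
     (\<exists>k. \<exists>A \<in> carrier_mat k n. \<exists>b \<in> carrier_vec k.
        P = {x \<in> carrier_vec n. A *\<^sub>v x \<le> b})"

end

theory Submission
  imports Defs
begin

text \<open>
  Two machines of demand 21 are used. Each of the four job collections
  8+8+5, 2+2+2+15, 7+7+5+2 and 3+3+15 has total capacity exactly 21, so the first two
  together, and the last two together, form a feasible supply. The midpoint of these two supplies
  is the integral supply 2, 2, 3, 5, 7, 8, 15 of total capacity 42. No part of it
  has total capacity 21, so one machine always receives at most 20, and 21/20 > 1.001.
\<close>

text \<open>Jobs of one type are interchangeable, so only the numbers \<open>a j\<close> and
  \<open>b j\<close> of type \<open>j\<close> jobs on machines 0 and 1 matter. This replaces the
  search over partial maps by arithmetic on counts.\<close>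

lemma assignable_two_machines_iff:
  assumes "num_machines I = 2"
  shows "assignable I T s \<longleftrightarrow>
    (\<exists>a b :: nat \<Rightarrow> nat. (\<forall>j < dim_vec s. a j + b j \<le> s $ j) \<and>
       T 0 \<le> (\<Sum>j < dim_vec s. real (a j) * capacity I $ j) \<and>
       T 1 \<le> (\<Sum>j < dim_vec s. real (b j) * capacity I $ j))"
    (is "_ \<longleftrightarrow> ?counts")
proof
  assume "assignable I T s"
  then obtain \<sigma> where load: "\<And>i. i < 2 \<Longrightarrow>
      T i \<le> (\<Sum>p \<in> {p \<in> jobs s. \<sigma> p = Some i}. capacity I $ fst p)"
    unfolding assignable_def assms by blast
  \<comment> \<open>The counts to be exhibited are the cardinalities of \<open>K 0 j\<close> and
    \<open>K 1 j\<close>. These sets are disjoint because \<sigma> is single-valued, so together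
    they fit into the supply of type \<open>j\<close>.\<close>
  define K where "K i j = {k \<in> {..<s $ j}. \<sigma> (j, k) = Some i}" for i j
  have load_K: "(\<Sum>p \<in> {p \<in> jobs s. \<sigma> p = Some i}. capacity I $ fst p)
      = (\<Sum>j < dim_vec s. real (card (K i j)) * capacity I $ j)" for i
  proof -
    have "{p \<in> jobs s. \<sigma> p = Some i} = (SIGMA j:{..<dim_vec s}. K i j)"
      by (auto simp: jobs_def K_def)
    then have "(\<Sum>p \<in> {p \<in> jobs s. \<sigma> p = Some i}. capacity I $ fst p)
        = (\<Sum>(j, k) \<in> (SIGMA j:{..<dim_vec s}. K i j). capacity I $ j)"
      by (simp add: case_prod_unfold)
    also have "\<dots> = (\<Sum>j < dim_vec s. \<Sum>k \<in> K i j. capacity I $ j)"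
      by (rule sum.Sigma [symmetric]) (auto simp: K_def)
    finally show ?thesis by simp
  qed
  have "card (K 0 j) + card (K 1 j) \<le> s $ j" for j
  proof -
    have "card (K 0 j) + card (K 1 j) = card (K 0 j \<union> K 1 j)"
      by (rule card_Un_disjoint [symmetric]) (auto simp: K_def)
    also have "\<dots> \<le> card {..<s $ j}"
      by (rule card_mono) (auto simp: K_def)
    finally show ?thesis by simp
  qed
  with load [of 0] load [of 1] show ?counts
    unfolding load_K by (intro exI [of _ "\<lambda>j. card (K 0 j)"] exI [of _ "\<lambda>j. card (K 1 j)"]) simp
next
  assume ?counts
  then obtain a b :: "nat \<Rightarrow> nat" where ab: "\<And>j. j < dim_vec s \<Longrightarrow> a j + b j \<le> s $ j"
    and load: "T 0 \<le> (\<Sum>j < dim_vec s. real (a j) * capacity I $ j)"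
      "T 1 \<le> (\<Sum>j < dim_vec s. real (b j) * capacity I $ j)"
    by blast
  \<comment> \<open>Of each type, the first \<open>a j\<close> jobs go to machine 0, the next
    \<open>b j\<close> to machine 1, and the rest stay unassigned; \<open>ab\<close> ensures that
    there are enough jobs.\<close>
  define \<sigma> :: "nat \<times> nat \<rightharpoonup> nat" where "\<sigma> = (\<lambda>(j, k).
    if j < dim_vec s \<and> k < a j then Some 0
    else if j < dim_vec s \<and> k < a j + b j then Some 1 else None)"
  have "{p \<in> jobs s. \<sigma> p = Some 0} = (SIGMA j:{..<dim_vec s}. {..<a j})"
    using ab by (fastforce simp: jobs_def \<sigma>_def split: if_splits)
  then have "(\<Sum>p \<in> {p \<in> jobs s. \<sigma> p = Some 0}. capacity I $ fst p)
      = (\<Sum>(j, k) \<in> (SIGMA j:{..<dim_vec s}. {..<a j}). capacity I $ j)"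
    by (simp add: case_prod_unfold)
  also have "\<dots> = (\<Sum>j < dim_vec s. \<Sum>k < a j. capacity I $ j)"
    by (rule sum.Sigma [symmetric]) auto
  finally have load0: "(\<Sum>p \<in> {p \<in> jobs s. \<sigma> p = Some 0}. capacity I $ fst p)
      = (\<Sum>j < dim_vec s. real (a j) * capacity I $ j)" by simp
  have "{p \<in> jobs s. \<sigma> p = Some 1} = (SIGMA j:{..<dim_vec s}. {a j..<a j + b j})"
    using ab by (fastforce simp: jobs_def \<sigma>_def split: if_splits)
  then have "(\<Sum>p \<in> {p \<in> jobs s. \<sigma> p = Some 1}. capacity I $ fst p)
      = (\<Sum>(j, k) \<in> (SIGMA j:{..<dim_vec s}. {a j..<a j + b j}). capacity I $ j)"
    by (simp add: case_prod_unfold)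
  also have "\<dots> = (\<Sum>j < dim_vec s. \<Sum>k \<in> {a j..<a j + b j}. capacity I $ j)"
    by (rule sum.Sigma [symmetric]) auto
  finally have load1: "(\<Sum>p \<in> {p \<in> jobs s. \<sigma> p = Some 1}. capacity I $ fst p)
      = (\<Sum>j < dim_vec s. real (b j) * capacity I $ j)" by simp
  have "dom \<sigma> \<subseteq> jobs s" "ran \<sigma> \<subseteq> {..<2}"
    using ab by (fastforce simp: jobs_def \<sigma>_def dom_def ran_def split: if_splits)+
  moreover have "T i \<le> (\<Sum>p \<in> {p \<in> jobs s. \<sigma> p = Some i}. capacity I $ fst p)" if "i < 2" for i
  proof -
    have "i = 0 \<or> i = 1" using that by linarith
    then show ?thesis using load load0 load1 by auto
  qed
  ultimately show "assignable I T s"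
    unfolding assignable_def assms by blast
qed

text \<open>Each row of the system is a linear inequality, and these survive convex combinations.
  The claim about polyhedra thereby reduces to the one about convex sets.\<close>

lemma polyhedron_vec_set_imp_convex:
  assumes "polyhedron_vec_set n P"
  shows "convex_vec_set n P"
proof -
  obtain k A b where A: "A \<in> carrier_mat k n" and b: "b \<in> carrier_vec k"
    and P: "P = {x \<in> carrier_vec n. A *\<^sub>v x \<le> b}"
    using assms unfolding polyhedron_vec_set_def by blast
  have "u \<cdot>\<^sub>v x + v \<cdot>\<^sub>v y \<in> P"
    if x: "x \<in> P" and y: "y \<in> P" and uv: "u \<ge> 0" "v \<ge> 0" "u + v = 1" for x y u v
  proof -
    have xy: "x \<in> carrier_vec n" "y \<in> carrier_vec n" using x y P by auto
    have "A *\<^sub>v (u \<cdot>\<^sub>v x + v \<cdot>\<^sub>v y) = u \<cdot>\<^sub>v (A *\<^sub>v x) + v \<cdot>\<^sub>v (A *\<^sub>v y)"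
      using A xy by (simp add: mult_add_distrib_mat_vec mult_mat_vec)
    moreover have "(u \<cdot>\<^sub>v (A *\<^sub>v x) + v \<cdot>\<^sub>v (A *\<^sub>v y)) $ i \<le> b $ i" if "i < k" for i
    proof -
      have "(A *\<^sub>v x) $ i \<le> b $ i" "(A *\<^sub>v y) $ i \<le> b $ i"
        using x y P b that by (auto simp: less_eq_vec_def)
      then have "u * (A *\<^sub>v x) $ i + v * (A *\<^sub>v y) $ i \<le> b $ i"
        using convex_bound_le uv by blast
      then show ?thesis using A that by simp
    qed
    ultimately have "A *\<^sub>v (u \<cdot>\<^sub>v x + v \<cdot>\<^sub>v y) \<le> b"
      unfolding less_eq_vec_def using A b by (simp del: index_mult_mat_vec)
    then show ?thesis
      using P xy by simp
  qed
  then show ?thesis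
    using P unfolding convex_vec_set_def by auto
qed

text \<open>The only use of convexity: the midpoint of two feasible supplies lies in
  \<open>P\<close>, and if it is integral, the approximation guarantee applies to it. The equation
  over the naturals says that \<open>r\<close> is this midpoint, hence integral.\<close>

lemma midpoint_assignable:
  assumes P: "convex_vec_set (num_types I) P" "approx_supply_set \<alpha> I P"
    and feas: "feasible_supply I s" "feasible_supply I t"
    and r: "r \<in> carrier_vec (num_types I)" "s + t = 2 \<cdot>\<^sub>v r"
  shows "assignable I (\<lambda>i. demand I $ i / \<alpha>) r"
proof -
  have st: "s \<in> carrier_vec (num_types I)" "t \<in> carrier_vec (num_types I)"
    using feas by (auto simp: feasible_supply_def)
  have "map_vec real s \<in> P" "map_vec real t \<in> P"
    using P feas by (auto simp: approx_supply_set_def)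
  then have "(1 / 2) \<cdot>\<^sub>v map_vec real s + (1 / 2) \<cdot>\<^sub>v map_vec real t \<in> P"
    using P(1) unfolding convex_vec_set_def by (auto simp del: smult_add_distrib_vec)
  moreover have "(1 / 2) \<cdot>\<^sub>v map_vec real s + (1 / 2) \<cdot>\<^sub>v map_vec real t = map_vec real r"
  proof (rule eq_vecI)
    fix i assume "i < dim_vec (map_vec real r)"
    then have i: "i < num_types I" using r by simp
    have "(s + t) $ i = (2 \<cdot>\<^sub>v r) $ i" using r(2) by simp
    then have "s $ i + t $ i = 2 * r $ i" using i st r(1) by auto
    then have "real (s $ i) + real (t $ i) = 2 * real (r $ i)"
      by (metis of_nat_add of_nat_mult of_nat_numeral)
    then show "((1 / 2) \<cdot>\<^sub>v map_vec real s + (1 / 2) \<cdot>\<^sub>v map_vec real t) $ i = map_vec real r $ i"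
      using i st r(1) by auto
  qed (use st r in auto)
  ultimately show ?thesis
    using P(2) r(1) unfolding approx_supply_set_def by auto
qed

text \<open>The types are ordered by increasing capacity; all supply vectors below list their job
  counts in this order.\<close>

definition gap_instance :: sched_instance where
  "gap_instance = \<lparr>demand = vec 2 (\<lambda>_. 21), capacity = vec 6 ((!) [2, 3, 5, 7, 8, 15])\<rparr>"

lemma gap_instance_machines [simp]: "num_machines gap_instance = 2"
  and gap_instance_types [simp]: "num_types gap_instance = 6"
  by (simp_all add: gap_instance_def)

lemma sum_lessThan_6: "(\<Sum>j < 6. f j) = f 0 + f 1 + f 2 + f 3 + f 4 + f (5 :: nat)"
  for f :: "nat \<Rightarrow> 'a :: comm_monoid_add"
  by (simp add: eval_nat_numeral add_ac)

lemma all_less_6: "(\<forall>j < (6 :: nat). Q j) \<longleftrightarrow> Q 0 \<and> Q 1 \<and> Q 2 \<and> Q 3 \<and> Q 4 \<and> Q 5"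
  by (simp add: eval_nat_numeral All_less_Suc conj_ac)

lemma P_Cmin_instance_gap_instance: "P_Cmin_instance gap_instance"
  unfolding P_Cmin_instance_def Q_Cmin_instance_def gap_instance_machines gap_instance_types
    all_less_6
  by (auto simp: gap_instance_def less_2_cases_iff)

text \<open>Loads appear as \<open>real\<close> of a natural number, so that integrality can later
  round a load above 20 up to 21.\<close>

lemma assignable_gap_instance_iff:
  assumes "dim_vec s = 6"
  shows "assignable gap_instance T s \<longleftrightarrow>
    (\<exists>a b :: nat \<Rightarrow> nat. (\<forall>j < 6. a j + b j \<le> s $ j) \<and>
       T 0 \<le> real (2 * a 0 + 3 * a 1 + 5 * a 2 + 7 * a 3 + 8 * a 4 + 15 * a 5) \<and>
       T 1 \<le> real (2 * b 0 + 3 * b 1 + 5 * b 2 + 7 * b 3 + 8 * b 4 + 15 * b 5))"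
  unfolding assignable_two_machines_iff [OF gap_instance_machines] assms sum_lessThan_6
  by (simp add: gap_instance_def mult.commute)

lemma feasible_gap_instance:
  "feasible_supply gap_instance (vec 6 ((!) [3, 0, 1, 0, 2, 1]))"
  "feasible_supply gap_instance (vec 6 ((!) [1, 2, 1, 2, 0, 1]))"
proof -
  have "assignable gap_instance (\<lambda>i. demand gap_instance $ i) (vec 6 ((!) [3, 0, 1, 0, 2, 1]))"
  proof (rule assignable_gap_instance_iff [THEN iffD2], simp, intro exI conjI)
    \<comment> \<open>The witnesses are 5+8+8 on machine 0 and 2+2+2+15 on machine 1.\<close>
    show "\<forall>j < 6. [0, 0, 1, 0, 2, 0] ! j + [3, 0, 0, 0, 0, 1] ! j
        \<le> (vec 6 ((!) [3, 0, 1, 0, 2, 1]) :: nat vec) $ j"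
      unfolding all_less_6 by simp
  qed (simp_all add: gap_instance_def)
  then show "feasible_supply gap_instance (vec 6 ((!) [3, 0, 1, 0, 2, 1]))"
    by (simp add: feasible_supply_def)
next
  have "assignable gap_instance (\<lambda>i. demand gap_instance $ i) (vec 6 ((!) [1, 2, 1, 2, 0, 1]))"
  proof (rule assignable_gap_instance_iff [THEN iffD2], simp, intro exI conjI)
    \<comment> \<open>The witnesses are 2+5+7+7 on machine 0 and 3+3+15 on machine 1.\<close>
    show "\<forall>j < 6. [1, 0, 1, 2, 0, 0] ! j + [0, 2, 0, 0, 0, 1] ! j
        \<le> (vec 6 ((!) [1, 2, 1, 2, 0, 1]) :: nat vec) $ j"
      unfolding all_less_6 by simp
  qed (simp_all add: gap_instance_def)
  then show "feasible_supply gap_instance (vec 6 ((!) [1, 2, 1, 2, 0, 1]))"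
    by (simp add: feasible_supply_def)
qed

text \<open>Two loads above 20 out of a total of 42 must both equal 21. A part of capacity 21
  containing the 15 needs 6 more from 2, 2, 3, 5, 7, 8; one without it omits exactly 6 of their
  total 27. No selection of these numbers sums to 6.\<close>

lemma not_assignable_gap_instance:
  assumes "T 0 > 20" "T 1 > 20"
  shows "\<not> assignable gap_instance T (vec 6 ((!) [2, 1, 1, 1, 1, 1]))"
proof
  assume "assignable gap_instance T (vec 6 ((!) [2, 1, 1, 1, 1, 1]))"
  then obtain a b :: "nat \<Rightarrow> nat" where
    ab: "a 0 + b 0 \<le> 2" "a 1 + b 1 \<le> 1" "a 2 + b 2 \<le> 1" "a 3 + b 3 \<le> 1"
      "a 4 + b 4 \<le> 1" "a 5 + b 5 \<le> 1"
    and "T 0 \<le> real (2 * a 0 + 3 * a 1 + 5 * a 2 + 7 * a 3 + 8 * a 4 + 15 * a 5)"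
      "T 1 \<le> real (2 * b 0 + 3 * b 1 + 5 * b 2 + 7 * b 3 + 8 * b 4 + 15 * b 5)"
    by (subst (asm) assignable_gap_instance_iff) (auto simp: all_less_6)
  with assms have "20 < 2 * a 0 + 3 * a 1 + 5 * a 2 + 7 * a 3 + 8 * a 4 + 15 * a 5"
      "20 < 2 * b 0 + 3 * b 1 + 5 * b 2 + 7 * b 3 + 8 * b 4 + 15 * b 5"
    by linarith+
  \<comment> \<open>Both integral loads are at least 21, and by \<open>ab\<close> they sum to at
    most 42.\<close>
  with ab have "2 * a 0 + 3 * a 1 + 5 * a 2 + 7 * a 3 + 8 * a 4 + 15 * a 5 = 21"
    by linarith
  \<comment> \<open>This leaves 3 * 2^5 = 96 choices of counts, all checked by evaluation.\<close>
  moreover have "a 0 \<in> {0, 1, 2}" "a 1 \<in> {0, 1}" "a 2 \<in> {0, 1}" "a 3 \<in> {0, 1}"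
      "a 4 \<in> {0, 1}" "a 5 \<in> {0, 1}"
    using ab by auto
  ultimately show False by auto
qed

lemma gap_instance_no_convex:
  assumes \<alpha>: "0 < \<alpha>" "\<alpha> < 1.001" and P: "convex_vec_set (num_types gap_instance) P"
  shows "\<not> approx_supply_set \<alpha> gap_instance P"
proof
  assume "approx_supply_set \<alpha> gap_instance P"
  with P have "assignable gap_instance (\<lambda>i. demand gap_instance $ i / \<alpha>)
      (vec 6 ((!) [2, 1, 1, 1, 1, 1]))"
  proof (rule midpoint_assignable [OF _ _ feasible_gap_instance])
    show "vec 6 ((!) [3, 0, 1, 0, 2, 1]) + vec 6 ((!) [1, 2, 1, 2, 0, 1])
        = (2 :: nat) \<cdot>\<^sub>v vec 6 ((!) [2, 1, 1, 1, 1, 1])"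
    proof (rule eq_vecI)
      have "\<forall>i < 6. (vec 6 ((!) [3, 0, 1, 0, 2, 1]) + vec 6 ((!) [1, 2, 1, 2, 0, 1])) $ i
        = ((2 :: nat) \<cdot>\<^sub>v vec 6 ((!) [2, 1, 1, 1, 1, 1])) $ i"
        unfolding all_less_6 by simp
      then show "(vec 6 ((!) [3, 0, 1, 0, 2, 1]) + vec 6 ((!) [1, 2, 1, 2, 0, 1])) $ i
        = ((2 :: nat) \<cdot>\<^sub>v vec 6 ((!) [2, 1, 1, 1, 1, 1])) $ i"
        if "i < dim_vec ((2 :: nat) \<cdot>\<^sub>v vec 6 ((!) [2, 1, 1, 1, 1, 1]))" for i
        using that by simp
    qed simp
  qed simp
  \<comment> \<open>Indeed 20 * 1.001 = 20.02 < 21.\<close>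
  moreover have "20 < 21 / \<alpha>"
    using \<alpha> by (simp add: field_simps)
  ultimately show False
    using not_assignable_gap_instance by (simp add: gap_instance_def)
qed

theorem theorem8:
  "(\<exists>I. P_Cmin_instance I \<and>
      (\<forall>\<alpha>::real. 0 < \<alpha> \<and> \<alpha> < 1.001 \<longrightarrow>
         \<not> (\<exists>P. convex_vec_set (num_types I) P \<and> approx_supply_set \<alpha> I P) \<and>
         \<not> (\<exists>P. polyhedron_vec_set (num_types I) P \<and> approx_supply_set \<alpha> I P))) \<and>
   (\<forall>\<alpha>::real. 0 < \<alpha> \<and> \<alpha> < 1.001 \<longrightarrow>
      \<not> (\<forall>I. P_Cmin_instance I \<longrightarrow>
            (\<exists>P. convex_vec_set (num_types I) P \<and> approx_supply_set \<alpha> I P)) \<and>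
      \<not> (\<forall>I. P_Cmin_instance I \<longrightarrow>
            (\<exists>P. polyhedron_vec_set (num_types I) P \<and> approx_supply_set \<alpha> I P)))"
  \<comment> \<open>One instance defeats every admissible \<alpha>, so it also refutes the two
    universal claims of the second half.\<close>
  using P_Cmin_instance_gap_instance gap_instance_no_convex polyhedron_vec_set_imp_convex by blast

end
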